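(* Let $G$ and $H$ be connected graphs. Then \[ \pi(G \mathbin{\square} H) \leq (\pi(G)+|G|)\, \pi(H). \]
   Context: All graphs are finite, simple, and have at least one vertex; $|G|$ denotes the number of vertices of $G$. A configuration on a connected graph $F$ is a placement of pebbles on its vertices (a function $V(F)\to\mathbb{Z}_{\ge 0}$); its size is the total number of pebbles. A pebbling move removes two pebbles from a vertex $u$ carrying at least two pebbles and places one pebble on a vertex adjacent to $u$. Given a root vertex $r$, a configuration is $r$-solvable if, after some finite (possibly empty) sequence of pebbling moves, there is at least one pebble on $r$. The pebbling number $\pi(F)$ is the least number $n$ such that, for every root $r\in V(F)$, every configuration of size $n$ is $r$-solvable. The box (cartesian) product $G \mathbin{\square} H$ is the graph with vertex set $V(G)\times V(H)$ in which $(g,h)$ and $(g',h')$ are adjacent exactly when ($g=g'$ and $h,h'$ are adjacent in $H$) or ($h=h'$ and $g,g'$ are adjacent in $G$). *)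

theory Defs
  imports "Graph_Theory.Graph_Theory"
begin

text \<open>
  A finite simple graph is a \<^locale>\<open>pair_graph\<close>: a finite, loop-free, symmetric relation
  \<^const>\<open>parcs\<close> on \<^const>\<open>pverts\<close>, each edge \<open>uv\<close> being represented by the two arcs
  \<open>(u, v)\<close> and \<open>(v, u)\<close>. \<^const>\<open>Digraph_Component.connected\<close> includes
  having at least one vertex.
\<close>

definition box_product :: "'a pair_pre_digraph \<Rightarrow> 'b pair_pre_digraph \<Rightarrow> ('a \<times> 'b) pair_pre_digraph"
  (infixl "\<box>" 70) where
  "G \<box> H =
    \<lparr> pverts = pverts G \<times> pverts H,
      parcs = {((g, h), (g', h')) | g h g' h'.
        (g \<in> pverts G \<and> g = g' \<and> (h, h') \<in> parcs H) \<or>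
        (h \<in> pverts H \<and> h = h' \<and> (g, g') \<in> parcs G)} \<rparr>"

text \<open>
  Functions on the vertex set are represented by total functions that vanish elsewhere.
\<close>

definition configuration :: "'a pair_pre_digraph \<Rightarrow> ('a \<Rightarrow> nat) \<Rightarrow> bool" where
  "configuration F c \<longleftrightarrow> (\<forall>v. v \<notin> pverts F \<longrightarrow> c v = 0)"

definition config_size :: "'a pair_pre_digraph \<Rightarrow> ('a \<Rightarrow> nat) \<Rightarrow> nat" where
  "config_size F c = (\<Sum>v\<in>pverts F. c v)"

definition pebbling_move :: "'a pair_pre_digraph \<Rightarrow> ('a \<Rightarrow> nat) \<Rightarrow> ('a \<Rightarrow> nat) \<Rightarrow> bool" where
  "pebbling_move F c c' \<longleftrightarrow>
    (\<exists>u v. (u, v) \<in> parcs F \<and> 2 \<le> c u \<and> c' = c(u := c u - 2, v := c v + 1))"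

definition solvable :: "'a pair_pre_digraph \<Rightarrow> 'a \<Rightarrow> ('a \<Rightarrow> nat) \<Rightarrow> bool" where
  "solvable F r c \<longleftrightarrow> (\<exists>c'. (pebbling_move F)\<^sup>*\<^sup>* c c' \<and> 1 \<le> c' r)"

definition always_solvable :: "'a pair_pre_digraph \<Rightarrow> nat \<Rightarrow> bool" where
  "always_solvable F n \<longleftrightarrow>
    (\<forall>r\<in>pverts F. \<forall>c. configuration F c \<and> config_size F c = n \<longrightarrow> solvable F r c)"

definition pebbling_number :: "'a pair_pre_digraph \<Rightarrow> nat" where
  "pebbling_number F = (LEAST n. always_solvable F n)"

text \<open>
  The minimum in \<^const>\<open>pebbling_number\<close> is attained for connected graphs, and the box product
  of connected graphs is a connected graph.
\<close>

lemma pebbling_moves_along_arc: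
  assumes "(u, v) \<in> parcs F" "u \<noteq> v" "2 * m \<le> c u"
  shows "\<exists>c'. (pebbling_move F)\<^sup>*\<^sup>* c c' \<and> m \<le> c' v"
  using assms(3)
proof (induction m arbitrary: c)
  case 0
  then show ?case by auto
next
  case (Suc m)
  have "\<exists>c'. (pebbling_move F)\<^sup>*\<^sup>* c c' \<and> c' u = c u - 2 * k \<and> c' v = c v + k"
    if "2 * k \<le> c u" for k
    using that
  proof (induction k)
    case 0
    then show ?case by auto
  next
    case (Suc k)
    then obtain c' where c': "(pebbling_move F)\<^sup>*\<^sup>* c c'" "c' u = c u - 2 * k" "c' v = c v + k"
      by auto
    let ?d = "c'(u := c' u - 2, v := c' v + 1)"
    have "pebbling_move F c' ?d"
      unfolding pebbling_move_def using assms(1) c'(2) Suc.prems by force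
    with c'(1) have "(pebbling_move F)\<^sup>*\<^sup>* c ?d" by simp
    moreover have "?d u = c u - 2 * Suc k" "?d v = c v + Suc k"
      using c' assms(2) by auto
    ultimately show ?case by blast
  qed
  from this[OF Suc.prems] show ?case by (metis le_add2)
qed

lemma solvable_if_many_pebbles:
  assumes "pair_graph F" "reachable (with_proj F) v r"
  shows "\<exists>N. \<forall>c. N \<le> c v \<longrightarrow> solvable F r c"
proof -
  interpret pair_graph F by fact
  from assms(2) show ?thesis
  proof (induction rule: converse_reachable_induct)
    case base
    have "\<forall>c. 1 \<le> c r \<longrightarrow> solvable F r c" unfolding solvable_def by blast
    then show ?case by blast
  next
    case (step x y)
    then obtain N where N: "\<And>c. N \<le> c y \<Longrightarrow> solvable F r c" by blast
    have arc: "(x, y) \<in> parcs F" using step by simp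
    have "solvable F r c" if "2 * N \<le> c x" for c
    proof -
      from pebbling_moves_along_arc[of x y F N c, OF arc no_loops'[OF arc] that] obtain c'
        where "(pebbling_move F)\<^sup>*\<^sup>* c c'" "N \<le> c' y" by blast
      with N[of c'] show ?thesis unfolding solvable_def by (meson rtranclp_trans)
    qed
    then show ?case by blast
  qed
qed

lemma always_solvable_exists:
  assumes "pair_graph F" "Digraph_Component.connected (with_proj F)"
  shows "\<exists>n. always_solvable F n"
proof -
  interpret pair_graph F by fact
  have sc: "strongly_connected (with_proj F)"
    using assms(2) symmetric_connected_imp_strongly_connected pair_sym_arcs by blast
  have "\<exists>N. \<forall>v\<in>pverts F. \<forall>r\<in>pverts F. \<forall>c. N v r \<le> c v \<longrightarrow> solvable F r c"
  proof -
    have "\<forall>v\<in>pverts F. \<forall>r\<in>pverts F. \<exists>N. \<forall>c. N \<le> c v \<longrightarrow> solvable F r c"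
      using sc solvable_if_many_pebbles[OF assms(1)] by (auto simp: strongly_connected_def)
    then show ?thesis by metis
  qed
  then obtain N where N: "\<And>v r c. v \<in> pverts F \<Longrightarrow> r \<in> pverts F \<Longrightarrow> N v r \<le> c v \<Longrightarrow> solvable F r c"
    by blast
  define M where "M = (\<Sum>v\<in>pverts F. \<Sum>r\<in>pverts F. N v r)"
  have fin: "finite (pverts F)" by (rule pair_finite_verts)
  have M: "N v r \<le> M" if "v \<in> pverts F" "r \<in> pverts F" for v r
  proof -
    have "N v r \<le> (\<Sum>r\<in>pverts F. N v r)" using fin that by (intro member_le_sum) auto
    also have "\<dots> \<le> M" unfolding M_def
      using fin that by (intro member_le_sum[of v _ "\<lambda>v. \<Sum>r\<in>pverts F. N v r"]) auto
    finally show ?thesis .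
  qed
  have "always_solvable F (card (pverts F) * M)"
    unfolding always_solvable_def
  proof (intro ballI allI impI)
    fix r c assume r: "r \<in> pverts F" and c: "configuration F c \<and> config_size F c = card (pverts F) * M"
    have "\<exists>v\<in>pverts F. M \<le> c v"
    proof (rule ccontr)
      assume "\<not> ?thesis"
      then have "(\<Sum>v\<in>pverts F. c v) < (\<Sum>v\<in>pverts F. M)"
        using fin r by (intro sum_strict_mono) auto
      with c show False by (simp add: config_size_def)
    qed
    then show "solvable F r c" using N M r by (meson le_trans)
  qed
  then show ?thesis by blast
qed

lemma pebbling_number_always_solvable:
  assumes "pair_graph F" "Digraph_Component.connected (with_proj F)"
  shows "always_solvable F (pebbling_number F)"
  using always_solvable_exists[OF assms] unfolding pebbling_number_def by (metis LeastI)

lemma pair_graph_box_product: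
  assumes "pair_graph G" "pair_graph H"
  shows "pair_graph (G \<box> H)"
proof -
  interpret G: pair_graph G by fact
  interpret H: pair_graph H by fact
  have sub: "parcs (G \<box> H) \<subseteq> pverts (G \<box> H) \<times> pverts (G \<box> H)"
    by (auto simp: box_product_def dest: G.wellformed' H.wellformed')
  have fin: "finite (pverts (G \<box> H))"
    by (simp add: box_product_def G.pair_finite_verts H.pair_finite_verts)
  have sym: "sym (parcs G)" "sym (parcs H)"
    using G.pair_sym_arcs H.pair_sym_arcs by (auto simp: symmetric_def)
  show ?thesis
  proof
    show "finite (parcs (G \<box> H))" using sub fin by (meson finite_SigmaI finite_subset)
    show "symmetric (with_proj (G \<box> H))"
      using sym by (auto simp: symmetric_def sym_def box_product_def)
    show "fst e \<noteq> snd e" if "e \<in> parcs (G \<box> H)" for e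
      using that by (auto simp: box_product_def dest: G.no_loops' H.no_loops')
  qed (use sub fin in auto)
qed

lemma connected_box_product:
  assumes "pair_graph G" "pair_graph H"
    and "Digraph_Component.connected (with_proj G)" "Digraph_Component.connected (with_proj H)"
  shows "Digraph_Component.connected (with_proj (G \<box> H))"
proof -
  interpret G: pair_graph G by fact
  interpret H: pair_graph H by fact
  interpret GH: pair_graph "G \<box> H" by (rule pair_graph_box_product) fact+
  have sc: "strongly_connected (with_proj G)" "strongly_connected (with_proj H)"
    using assms G.symmetric_connected_imp_strongly_connected G.pair_sym_arcs
      H.symmetric_connected_imp_strongly_connected H.pair_sym_arcs by blast+
  have 1: "reachable (with_proj (G \<box> H)) (g, h) (g', h)"
    if "reachable (with_proj G) g g'" "h \<in> pverts H" for g g' h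
    using that(1)
  proof (induction rule: G.converse_reachable_induct)
    case base
    then show ?case using that by (intro GH.reachable_refl) (auto simp: box_product_def)
  next
    case (step x y)
    then have "((x, h), (y, h)) \<in> parcs (G \<box> H)" using that by (auto simp: box_product_def)
    with step show ?case by (metis GH.adj_reachable_trans with_proj_simps(3))
  qed
  have 2: "reachable (with_proj (G \<box> H)) (g, h) (g, h')"
    if "reachable (with_proj H) h h'" "g \<in> pverts G" for g h h'
    using that(1)
  proof (induction rule: H.converse_reachable_induct)
    case base
    then show ?case using that by (intro GH.reachable_refl) (auto simp: box_product_def)
  next
    case (step x y)
    then have "((g, x), (g, y)) \<in> parcs (G \<box> H)" using that by (auto simp: box_product_def)
    with step show ?case by (metis GH.adj_reachable_trans with_proj_simps(3))
  qed
  have V: "pverts (G \<box> H) = pverts G \<times> pverts H" by (simp add: box_product_def)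
  have "strongly_connected (with_proj (G \<box> H))"
  proof (rule strongly_connectedI)
    show "verts (with_proj (G \<box> H)) \<noteq> {}" using sc by (auto simp: V strongly_connected_def)
    fix u v assume "u \<in> verts (with_proj (G \<box> H))" "v \<in> verts (with_proj (G \<box> H))"
    then obtain g h g' h' where *: "u = (g, h)" "v = (g', h')"
      "g \<in> pverts G" "g' \<in> pverts G" "h \<in> pverts H" "h' \<in> pverts H"
      by (auto simp: V)
    have "reachable (with_proj (G \<box> H)) (g, h) (g', h)"
      using 1 sc * by (auto simp: strongly_connected_def)
    moreover have "reachable (with_proj (G \<box> H)) (g', h) (g', h')"
      using 2 sc * by (auto simp: strongly_connected_def)
    ultimately show "reachable (with_proj (G \<box> H)) u v"
      unfolding * by (rule GH.reachable_trans)
  qed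
  then show ?thesis
    using GH.reachable_mk_symmetric_eq[OF GH.sym_arcs]
    by (auto simp: Digraph_Component.connected_def strongly_connected_def)
qed

end

theory Submission
  imports Defs
begin

text \<open>
  Split the pebbles on \<open>G \<box> H\<close> by the copies \<open>{g} \<times> H\<close> of \<open>H\<close>, and let the root be \<open>(r, s)\<close>.
  Write \<open>p\<close> for the pebbling number of \<open>H\<close>. Pebbles can be grouped into disjoint batches of \<open>p\<close>,
  and each batch brings a pebble to the root without using the others, so a copy with \<open>x\<close> pebbles
  can send \<open>x div p\<close> of them to \<open>(g, s)\<close> (\<open>many_pebbles_reach_root\<close>). Each copy
  leaves fewer than \<open>p\<close> pebbles unused, so starting with \<open>(\<pi>(G) + |G|) * p\<close> pebbles, at least
  \<open>\<pi>(G)\<close> pebbles end up on the copy \<open>G \<times> {s}\<close> of \<open>G\<close>. These suffice to reach \<open>(r, s)\<close> inside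
  that copy.

  Both the independence of the batches and the passage from \<open>G\<close> or \<open>H\<close> to its copies in the product
  are instances of one fact: moves of some of the pebbles on an embedded graph can be replayed while
  all other pebbles stay where they are (\<open>replay_moves\<close>).
\<close>

text \<open>
  The configuration \<open>c\<close> contains the image of \<open>d\<close>, and replaying the moves replaces that image by the
  image of \<open>d'\<close>; the balance is written additively to avoid truncated subtraction. With the identity
  as embedding, this says that additional pebbles never hinder moves.
\<close>

lemma replay_moves:
  assumes moves: "(pebbling_move F)\<^sup>*\<^sup>* d d'"
    and "inj i" and arcs: "\<And>u v. (u, v) \<in> parcs F \<Longrightarrow> (i u, i v) \<in> parcs F'"
    and le: "\<And>v. d v \<le> c (i v)"
  obtains c' where "(pebbling_move F')\<^sup>*\<^sup>* c c'"
    and "\<And>v. c' (i v) + d v = c (i v) + d' v"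
    and "\<And>w. w \<notin> range i \<Longrightarrow> c' w = c w"
proof -
  have "\<exists>c'. (pebbling_move F')\<^sup>*\<^sup>* c c' \<and> (\<forall>v. c' (i v) + d v = c (i v) + d' v)
      \<and> (\<forall>w. w \<notin> range i \<longrightarrow> c' w = c w)"
    using moves
  proof (induction rule: rtranclp_induct)
    case base
    then show ?case by blast
  next
    case (step e e')
    then obtain b where b: "(pebbling_move F')\<^sup>*\<^sup>* c b"
      "\<And>v. b (i v) + d v = c (i v) + e v" "\<And>w. w \<notin> range i \<Longrightarrow> b w = c w"
      by blast
    obtain u v where uv: "(u, v) \<in> parcs F" "2 \<le> e u" "e' = e(u := e u - 2, v := e v + 1)"
      using step.hyps(2) unfolding pebbling_move_def by blast
    have e_le_b: "e x \<le> b (i x)" for x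
      using b(2)[of x] le[of x] by linarith
    define b' where "b' = b(i u := b (i u) - 2, i v := b (i v) + 1)"
    have balance: "b' (i x) + d x = c (i x) + e' x" for x
      using b(2)[of x] b(2)[of u] e_le_b[of u] uv(2,3) \<open>inj i\<close> by (auto simp: b'_def inj_eq)
    have "pebbling_move F' b b'"
      unfolding pebbling_move_def b'_def using arcs[OF uv(1)] e_le_b[of u] uv(2) by force
    with b(1) have "(pebbling_move F')\<^sup>*\<^sup>* c b'"
      by simp
    moreover have "b' w = c w" if "w \<notin> range i" for w
      using that b(3) by (auto simp: b'_def)
    ultimately show ?case
      using balance by blast
  qed
  with that show ?thesis by blast
qed

lemma sum_eq_below:
  fixes c :: "'a \<Rightarrow> nat"
  assumes "n \<le> sum c A"
  obtains d where "\<And>v. d v \<le> c v" "sum d A = n"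
proof -
  have "\<exists>d. (\<forall>v. d v \<le> c v) \<and> sum d A = n"
    using assms
  proof (induction n)
    case 0
    then show ?case by (intro exI[of _ "\<lambda>_. 0"]) auto
  next
    case (Suc n)
    then obtain d where d: "\<And>v. d v \<le> c v" "sum d A = n" by auto
    have fin: "finite A" using Suc.prems by (metis not_less_eq_eq sum.infinite zero_le)
    have "\<exists>v\<in>A. d v < c v"
      using Suc.prems d(2) sum_mono[of A c d] by (metis Suc_n_not_le_n le_trans not_le_imp_less)
    then obtain v where v: "v \<in> A" "d v < c v" by blast
    have "sum (d(v := d v + 1)) A = Suc n"
      using fin v(1) d(2) by (simp add: sum.remove[of A v])
    with d(1) v(2) show ?case by (intro exI[of _ "d(v := d v + 1)"]) auto
  qed
  with that show ?thesis by blast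
qed

text \<open>
  One batch of \<open>n\<close> pebbles is split off and solved; the remaining pebbles contain the other \<open>k\<close>
  batches, whose solution is replayed on top of what the first batch left behind, including its
  pebble on the root.
\<close>

lemma many_pebbles_reach_root:
  assumes "always_solvable F n" "r \<in> pverts F"
    and "configuration F c" "k * n \<le> config_size F c"
  obtains c' where "(pebbling_move F)\<^sup>*\<^sup>* c c'" "k \<le> c' r"
proof -
  have "\<exists>c'. (pebbling_move F)\<^sup>*\<^sup>* c c' \<and> k \<le> c' r"
    using assms(3,4)
  proof (induction k arbitrary: c)
    case 0
    then show ?case by auto
  next
    case (Suc k)
    from Suc.prems(2) have "n \<le> sum c (pverts F)"
      by (simp add: config_size_def)
    then obtain d where d: "\<And>v. d v \<le> c v" "sum d (pverts F) = n"
      by (rule sum_eq_below) blast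
    have "configuration F d" "config_size F d = n"
      using Suc.prems(1) d unfolding configuration_def config_size_def by (metis le_zero_eq, blast)
    then obtain d' where d': "(pebbling_move F)\<^sup>*\<^sup>* d d'" "1 \<le> d' r"
      using assms(1,2) unfolding always_solvable_def solvable_def by blast
    obtain c1 where c1: "(pebbling_move F)\<^sup>*\<^sup>* c c1" "\<And>v. c1 v + d v = c v + d' v"
      using replay_moves[OF d'(1), of id F c] d(1) by auto
    let ?rest = "\<lambda>v. c v - d v"
    have "config_size F ?rest = config_size F c - n"
      using d by (simp add: config_size_def sum_subtractf_nat)
    moreover have "configuration F ?rest"
      using Suc.prems(1) by (simp add: configuration_def)
    ultimately have "\<exists>e. (pebbling_move F)\<^sup>*\<^sup>* ?rest e \<and> k \<le> e r"
      using Suc.prems(2) by (intro Suc.IH) auto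
    then obtain e where e: "(pebbling_move F)\<^sup>*\<^sup>* ?rest e" "k \<le> e r"
      by blast
    have rest_le: "?rest v \<le> c1 v" for v
      using c1(2)[of v] by linarith
    obtain c2 where c2: "(pebbling_move F)\<^sup>*\<^sup>* c1 c2" "\<And>v. c2 v + ?rest v = c1 v + e v"
      using replay_moves[OF e(1), of id F c1] rest_le by auto
    have "Suc k \<le> c2 r"
      using c2(2)[of r] c1(2)[of r] d(1)[of r] d'(2) e(2) by linarith
    moreover have "(pebbling_move F)\<^sup>*\<^sup>* c c2"
      using c1(1) c2(1) by simp
    ultimately show ?case by blast
  qed
  with that show ?thesis by blast
qed

lemma always_solvable_pos:
  assumes "pverts F \<noteq> {}" "always_solvable F n"
  shows "0 < n"
proof (rule ccontr)
  assume "\<not> 0 < n"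
  with assms obtain r where "solvable F r (\<lambda>_. 0)"
    unfolding always_solvable_def configuration_def config_size_def by fastforce
  then obtain c' where "(pebbling_move F)\<^sup>*\<^sup>* (\<lambda>_. 0) c'" "1 \<le> c' r"
    unfolding solvable_def by blast
  then show False
    by (cases rule: converse_rtranclpE) (auto simp: pebbling_move_def)
qed

text \<open>
  Moves inside one copy of \<open>H\<close> leave the other copies untouched, so the copies can be treated one
  after the other.
\<close>

lemma gather_in_copies:
  assumes H: "always_solvable H p" "s \<in> pverts H" and "0 < p"
    and c: "configuration (G \<box> H) c"
    and "finite A" "A \<subseteq> pverts G"
  obtains c' where "(pebbling_move (G \<box> H))\<^sup>*\<^sup>* c c'"
    and "\<And>g. g \<in> A \<Longrightarrow> (\<Sum>h\<in>pverts H. c (g, h)) div p \<le> c' (g, s)"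
proof -
  have "\<exists>c'. (pebbling_move (G \<box> H))\<^sup>*\<^sup>* c c'
      \<and> (\<forall>g\<in>A. (\<Sum>h\<in>pverts H. c (g, h)) div p \<le> c' (g, s))
      \<and> (\<forall>g h. g \<notin> A \<longrightarrow> c' (g, h) = c (g, h))"
    using assms(5,6)
  proof (induction A rule: finite_induct)
    case empty
    then show ?case by blast
  next
    case (insert g A)
    then obtain b where b: "(pebbling_move (G \<box> H))\<^sup>*\<^sup>* c b"
      "\<And>g. g \<in> A \<Longrightarrow> (\<Sum>h\<in>pverts H. c (g, h)) div p \<le> b (g, s)"
      "\<And>g h. g \<notin> A \<Longrightarrow> b (g, h) = c (g, h)"
      by auto
    let ?d = "\<lambda>h. c (g, h)" and ?k = "(\<Sum>h\<in>pverts H. c (g, h)) div p"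
    have "configuration H ?d"
      using c by (simp add: configuration_def box_product_def)
    then obtain d' where d': "(pebbling_move H)\<^sup>*\<^sup>* ?d d'" "?k \<le> d' s"
      using many_pebbles_reach_root[OF H, of ?d ?k] by (auto simp: config_size_def)
    have arcs: "((g, u), (g, v)) \<in> parcs (G \<box> H)" if "(u, v) \<in> parcs H" for u v
      using that insert.prems by (simp add: box_product_def)
    obtain b' where b': "(pebbling_move (G \<box> H))\<^sup>*\<^sup>* b b'"
      "\<And>h. b' (g, h) + ?d h = b (g, h) + d' h" "\<And>w. w \<notin> range (Pair g) \<Longrightarrow> b' w = b w"
      using replay_moves[OF d'(1), of "Pair g" "G \<box> H" b] arcs b(3)[OF insert.hyps(2)]
      by (auto simp: inj_def)
    have same: "b' (g', h) = b (g', h)" if "g' \<noteq> g" for g' h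
      using b'(3) that by auto
    have "(\<Sum>h\<in>pverts H. c (g', h)) div p \<le> b' (g', s)" if "g' \<in> insert g A" for g'
    proof (cases "g' = g")
      case True
      then show ?thesis using b'(2)[of s] b(3)[OF insert.hyps(2), of s] d'(2) by simp
    next
      case False
      then show ?thesis using b(2) same that by simp
    qed
    moreover have "(pebbling_move (G \<box> H))\<^sup>*\<^sup>* c b'"
      using b(1) b'(1) by simp
    ultimately show ?case using same b(3) by (intro exI[of _ b']) auto
  qed
  with that show ?thesis by blast
qed

lemma sum_div_ge:
  fixes x :: "'a \<Rightarrow> nat"
  assumes "0 < p" "(m + card A) * p \<le> sum x A"
  shows "m \<le> (\<Sum>a\<in>A. x a div p)"
proof -
  have "sum x A \<le> (\<Sum>a\<in>A. (x a div p + 1) * p)"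
    using assms(1) by (intro sum_mono) (simp add: dividend_less_div_times less_imp_le)
  also have "\<dots> = ((\<Sum>a\<in>A. x a div p) + card A) * p"
    unfolding sum_distrib_right[symmetric] sum.distrib by simp
  finally have "(m + card A) * p \<le> ((\<Sum>a\<in>A. x a div p) + card A) * p"
    using assms(2) by linarith
  with assms(1) show ?thesis by simp
qed

theorem always_solvable_box_product:
  assumes G: "always_solvable G n" "finite (pverts G)"
    and H: "always_solvable H p" "pverts H \<noteq> {}"
  shows "always_solvable (G \<box> H) ((n + card (pverts G)) * p)"
  unfolding always_solvable_def
proof (intro ballI allI impI, elim conjE)
  fix w c
  assume w: "w \<in> pverts (G \<box> H)" and c: "configuration (G \<box> H) c"
    and size: "config_size (G \<box> H) c = (n + card (pverts G)) * p"
  obtain r s where rs: "w = (r, s)" "r \<in> pverts G" "s \<in> pverts H"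
    using w by (auto simp: box_product_def)
  have p: "0 < p"
    using H by (intro always_solvable_pos)
  obtain b where b: "(pebbling_move (G \<box> H))\<^sup>*\<^sup>* c b"
    "\<And>g. g \<in> pverts G \<Longrightarrow> (\<Sum>h\<in>pverts H. c (g, h)) div p \<le> b (g, s)"
    using gather_in_copies[OF H(1) rs(3) p c G(2)] by blast
  have "(\<Sum>g\<in>pverts G. \<Sum>h\<in>pverts H. c (g, h)) = (n + card (pverts G)) * p"
    using size by (simp add: config_size_def box_product_def sum.cartesian_product)
  then have "n \<le> (\<Sum>g\<in>pverts G. (\<Sum>h\<in>pverts H. c (g, h)) div p)"
    by (intro sum_div_ge[OF p]) simp
  also have "\<dots> \<le> (\<Sum>g\<in>pverts G. b (g, s))"
    using b(2) by (rule sum_mono)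
  finally have gathered: "n \<le> (\<Sum>g\<in>pverts G. b (g, s))" .
  let ?d = "\<lambda>g. if g \<in> pverts G then b (g, s) else 0"
  have "configuration G ?d" "1 * n \<le> config_size G ?d"
    using gathered by (simp_all add: configuration_def config_size_def)
  then obtain d' where d': "(pebbling_move G)\<^sup>*\<^sup>* ?d d'" "1 \<le> d' r"
    using many_pebbles_reach_root[OF G(1) rs(2)] by blast
  have arcs: "((u, s), (v, s)) \<in> parcs (G \<box> H)" if "(u, v) \<in> parcs G" for u v
    using that rs(3) by (simp add: box_product_def)
  obtain b' where b': "(pebbling_move (G \<box> H))\<^sup>*\<^sup>* b b'"
    "\<And>g. b' (g, s) + ?d g = b (g, s) + d' g"
    by (rule replay_moves[of G ?d d' "\<lambda>g. (g, s)" "G \<box> H" b])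
      (use d'(1) arcs in \<open>auto simp: inj_def\<close>)
  have "1 \<le> b' w"
    using b'(2)[of r] d'(2) rs by simp
  moreover have "(pebbling_move (G \<box> H))\<^sup>*\<^sup>* c b'"
    using b(1) b'(1) by simp
  ultimately show "solvable (G \<box> H) w c"
    unfolding solvable_def by blast
qed

theorem proposition3p2:
  fixes G :: "'a pair_pre_digraph" and H :: "'b pair_pre_digraph"
  assumes "pair_graph G" and "Digraph_Component.connected (with_proj G)"
    and "pair_graph H" and "Digraph_Component.connected (with_proj H)"
  shows "pebbling_number (G \<box> H) \<le> (pebbling_number G + card (pverts G)) * pebbling_number H"
proof -
  interpret G: pair_graph G by fact
  have "pverts H \<noteq> {}"
    using assms(4) by (auto simp: Digraph_Component.connected_def strongly_connected_def)
  then have "always_solvable (G \<box> H)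
      ((pebbling_number G + card (pverts G)) * pebbling_number H)"
    using assms by (intro always_solvable_box_product pebbling_number_always_solvable
        G.pair_finite_verts)
  then show ?thesis
    unfolding pebbling_number_def[of "G \<box> H"] by (rule Least_le)
qed

end
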